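(* Let $q\ge0$, $t\ge1$, $k\ge1$ be integers. The critical group $K(W_k(q,t))$ is isomorphic to a direct product of at most two cyclic groups.
   Context: $W_k(q,t)$ is the directed multigraph with hub $v_0$ and rim vertices $v_1,\dots,v_k$ (clockwise, indices mod $k$), with $t$ edges each way between $v_0$ and each $v_i$, one edge $v_i\to v_{i-1}$ and $q$ edges $v_i\to v_{i+1}$. Its critical group $K(W_k(q,t))$ (dollar game with bank $v_0$) is isomorphic to $\mathbb{Z}^k/\overline{M}_k\mathbb{Z}^k$, where $\overline{M}_1=[t]$, $\overline{M}_2=\begin{pmatrix}1+q+t&-1-q\\-1-q&1+q+t\end{pmatrix}$, and for $k\ge3$ $\overline{M}_k$ is the $k\times k$ matrix with diagonal entries $1+q+t$, entries $(i,i+1\bmod k)$ equal to $-q$, entries $(i,i-1\bmod k)$ equal to $-1$, and all other entries $0$. *)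

theory Defs
  imports "Graph_Theory.Digraph" "HOL-Algebra.Elementary_Groups"
begin

section \<open>The dollar game on a directed multigraph\<close>

definition mult_arcs :: "('a, 'b) pre_digraph \<Rightarrow> 'a \<Rightarrow> 'a \<Rightarrow> nat" where
  "mult_arcs G u v = card (out_arcs G u \<inter> in_arcs G v)"

text \<open>
  A configuration assigns a nonnegative number of dollars to every vertex other than the bank \<open>b\<close>.
  The balance of the bank is minus the total of the other vertices, so it is not recorded: the value
  at \<open>b\<close> is fixed to be 0.
\<close>

definition configuration :: "('a, 'b) pre_digraph \<Rightarrow> 'a \<Rightarrow> ('a \<Rightarrow> nat) \<Rightarrow> bool" where
  "configuration G b c \<longleftrightarrow> (\<forall>v. v \<notin> verts G - {b} \<longrightarrow> c v = 0)"

definition stable :: "('a, 'b) pre_digraph \<Rightarrow> 'a \<Rightarrow> ('a \<Rightarrow> nat) \<Rightarrow> bool" where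
  "stable G b c \<longleftrightarrow> (\<forall>v \<in> verts G - {b}. c v < out_degree G v)"

text \<open>
  The bank may always go into debt, but it fires only when no other vertex is able to.
\<close>

definition can_fire :: "('a, 'b) pre_digraph \<Rightarrow> 'a \<Rightarrow> ('a \<Rightarrow> nat) \<Rightarrow> 'a \<Rightarrow> bool" where
  "can_fire G b c u \<longleftrightarrow>
     u \<in> verts G \<and> (if u = b then stable G b c else out_degree G u \<le> c u)"

text \<open>
  The subtraction does not truncate when the firing is legal. A loop at \<open>u\<close> counts in the
  out-degree of \<open>u\<close> and returns its dollar to \<open>u\<close>.
\<close>

definition fire :: "('a, 'b) pre_digraph \<Rightarrow> 'a \<Rightarrow> 'a \<Rightarrow> ('a \<Rightarrow> nat) \<Rightarrow> ('a \<Rightarrow> nat)" where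
  "fire G b u c =
     (\<lambda>v. if v \<in> verts G - {b}
          then c v - (if v = u then out_degree G u else 0) + mult_arcs G u v
          else 0)"

definition game_step :: "('a, 'b) pre_digraph \<Rightarrow> 'a \<Rightarrow> ('a \<Rightarrow> nat) \<Rightarrow> ('a \<Rightarrow> nat) \<Rightarrow> bool" where
  "game_step G b c d \<longleftrightarrow> (\<exists>u. can_fire G b c u \<and> d = fire G b u c)"

definition recurrent :: "('a, 'b) pre_digraph \<Rightarrow> 'a \<Rightarrow> ('a \<Rightarrow> nat) \<Rightarrow> bool" where
  "recurrent G b c \<longleftrightarrow> (game_step G b)\<^sup>+\<^sup>+ c c"

definition critical :: "('a, 'b) pre_digraph \<Rightarrow> 'a \<Rightarrow> ('a \<Rightarrow> nat) \<Rightarrow> bool" where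
  "critical G b c \<longleftrightarrow> configuration G b c \<and> stable G b c \<and> recurrent G b c"

definition critical_of :: "('a, 'b) pre_digraph \<Rightarrow> 'a \<Rightarrow> ('a \<Rightarrow> nat) \<Rightarrow> ('a \<Rightarrow> nat)" where
  "critical_of G b c = (THE d. critical G b d \<and> (game_step G b)\<^sup>*\<^sup>* c d)"

definition critical_group :: "('a, 'b) pre_digraph \<Rightarrow> 'a \<Rightarrow> ('a \<Rightarrow> nat) monoid" where
  "critical_group G b =
     \<lparr> carrier = {c. critical G b c},
       monoid.mult = (\<lambda>c d. critical_of G b (\<lambda>v. c v + d v)),
       one = critical_of G b (\<lambda>_. 0) \<rparr>"

section \<open>The graphs \<open>W\<^sub>k(q,t)\<close>\<close>

definition rim_next :: "nat \<Rightarrow> nat \<Rightarrow> nat" where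
  "rim_next k i = (if i = k then 1 else i + 1)"

definition rim_prev :: "nat \<Rightarrow> nat \<Rightarrow> nat" where
  "rim_prev k i = (if i = 1 then k else i - 1)"

text \<open>
  The first argument of an arc is the index of its rim vertex (for \<open>Backward\<close> and \<open>Forward\<close>: of its
  tail); the second one numbers parallel arcs.
\<close>

datatype wheel_arc =
    From_Hub nat nat
  | To_Hub nat nat
  | Backward nat
  | Forward nat nat

fun wheel_tail :: "wheel_arc \<Rightarrow> nat" where
  "wheel_tail (From_Hub i j) = 0"
| "wheel_tail (To_Hub i j) = i"
| "wheel_tail (Backward i) = i"
| "wheel_tail (Forward i j) = i"

fun wheel_head :: "nat \<Rightarrow> wheel_arc \<Rightarrow> nat" where
  "wheel_head k (From_Hub i j) = i"
| "wheel_head k (To_Hub i j) = 0"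
| "wheel_head k (Backward i) = rim_prev k i"
| "wheel_head k (Forward i j) = rim_next k i"

text \<open>
  The hub is the vertex 0. As \<open>rim_prev\<close> and \<open>rim_next\<close> coincide for \<open>k = 2\<close>, there are then \<open>1 + q\<close>
  arcs from each rim vertex to the other one; for \<open>k = 1\<close> the rim arcs are \<open>1 + q\<close> loops, which
  cancel in the Laplacian.
\<close>

definition wheel :: "nat \<Rightarrow> nat \<Rightarrow> nat \<Rightarrow> (nat, wheel_arc) pre_digraph" where
  "wheel k q t =
     \<lparr> verts = {0..k},
       arcs = {From_Hub i j | i j. i \<in> {1..k} \<and> j < t}
            \<union> {To_Hub i j | i j. i \<in> {1..k} \<and> j < t}
            \<union> {Backward i | i. i \<in> {1..k}}
            \<union> {Forward i j | i j. i \<in> {1..k} \<and> j < q},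
       tail = wheel_tail,
       head = wheel_head k \<rparr>"

lemma out_degree_wheel_rim:
  assumes "i \<in> {1..k}"
  shows "out_degree (wheel k q t) i = 1 + q + t"
proof -
  have "out_arcs (wheel k q t) i = To_Hub i ` {..<t} \<union> ({Backward i} \<union> Forward i ` {..<q})"
    using assms by (auto simp: out_arcs_def wheel_def)
  moreover have "card (To_Hub i ` {..<t}) = t" "card (Forward i ` {..<q}) = q"
    by (auto simp: card_image inj_on_def)
  moreover from this
  have "card (To_Hub i ` {..<t} \<union> Forward i ` {..<q}) = t + q"
    by (subst card_Un_disjoint) auto
  ultimately show ?thesis
    unfolding out_degree_def by (auto simp: card_insert_if)
qed

lemma mult_arcs_wheel_rim:
  assumes "i \<in> {1..k}" "j \<in> {1..k}"
  shows "mult_arcs (wheel k q t) i j =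
    (if j = rim_prev k i then 1 else 0) + (if j = rim_next k i then q else 0)"
proof -
  have "out_arcs (wheel k q t) i \<inter> in_arcs (wheel k q t) j =
      (if j = rim_prev k i then {Backward i} else {}) \<union>
      (if j = rim_next k i then Forward i ` {..<q} else {})"
    using assms by (auto simp: out_arcs_def in_arcs_def wheel_def)
  moreover have "card (Forward i ` {..<q}) = q"
    by (auto simp: card_image inj_on_def)
  ultimately show ?thesis
    unfolding mult_arcs_def by (auto simp: card_insert_if)
qed

lemma mult_arcs_wheel_hub:
  assumes "i \<in> {1..k}"
  shows "mult_arcs (wheel k q t) 0 i = t" "mult_arcs (wheel k q t) i 0 = t"
proof -
  have "out_arcs (wheel k q t) 0 \<inter> in_arcs (wheel k q t) i = From_Hub i ` {..<t}"
       "out_arcs (wheel k q t) i \<inter> in_arcs (wheel k q t) 0 = To_Hub i ` {..<t}"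
    using assms by (auto simp: out_arcs_def in_arcs_def wheel_def rim_prev_def rim_next_def
        split: if_splits)
  then show "mult_arcs (wheel k q t) 0 i = t" "mult_arcs (wheel k q t) i 0 = t"
    by (auto simp: mult_arcs_def card_image inj_on_def)
qed

end

theory Submission
  imports Defs
begin

text \<open>
  Every rim firing lowers the total on the rim by \<open>t\<close>, so each configuration reaches a critical one.
  A recurrent configuration has no forbidden subset, which makes the critical configuration in each
  coset of the Laplacian lattice unique. The critical group is therefore the quotient of the integer
  configurations by this lattice. Firing \<open>i\<close> gives \<open>(1 + q + t) e\<^sub>i = e\<^sub>i\<^sub>-\<^sub>1 + q e\<^sub>i\<^sub>+\<^sub>1\<close> in the quotient, so
  the unit vectors at two adjacent rim vertices generate it, and a quotient of the plane lattice is
  a product of two cyclic groups.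
\<close>

section \<open>Subgroups of the plane lattice\<close>

text \<open>Euclidean division by the least positive member leaves a remainder that is again a
  member, hence zero. The zero subgroup has \<open>h = 0\<close>, since 0 divides only 0.\<close>

lemma int_subgroup_multiples:
  fixes S :: "int \<Rightarrow> bool"
  assumes zero: "S 0" and diff: "\<And>x y. S x \<Longrightarrow> S y \<Longrightarrow> S (x - y)"
  shows "\<exists>h::nat. \<forall>x. S x \<longleftrightarrow> int h dvd x"
proof (cases "\<exists>n>0. S (int n)")
  case False
  have "x = 0" if "S x" for x
  proof (rule ccontr)
    assume "x \<noteq> 0"
    have "S (- x)" using diff[OF zero that] by simp
    then have "S (int (nat \<bar>x\<bar>))" using that by (auto simp: abs_if)
    with False \<open>x \<noteq> 0\<close> show False by (metis zero_less_abs_iff zero_less_nat_eq)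
  qed
  with zero show ?thesis by (intro exI[of _ 0]) auto
next
  case True
  define h where "h = (LEAST n. n > 0 \<and> S (int n))"
  have h: "h > 0" "S (int h)"
    using LeastI_ex[OF True] by (auto simp: h_def)
  have add: "S (x + y)" if "S x" "S y" for x y
    using diff[OF that(1) diff[OF zero that(2)]] by simp
  have nat_mult: "S (int n * int h)" for n
    by (induction n) (auto simp: zero algebra_simps intro: add h)
  have mult: "S (n * int h)" for n
    using nat_mult[of "nat n"] diff[OF zero nat_mult[of "nat (- n)"]]
    by (cases "n \<ge> 0") auto
  have "int h dvd x" if "S x" for x
  proof -
    have "S (x - (x div int h) * int h)" using diff[OF that mult] .
    then have "S (int (nat (x mod int h)))"
      using h by (simp add: minus_div_mult_eq_mod)
    moreover have "nat (x mod int h) < h" using h by (simp add: nat_less_iff)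
    ultimately have "nat (x mod int h) = 0"
      using not_less_Least[of "nat (x mod int h)" "\<lambda>n. n > 0 \<and> S (int n)"] by (auto simp: h_def)
    moreover have "x mod int h \<ge> 0" using h by simp
    ultimately show ?thesis by (simp add: dvd_eq_mod_eq_0)
  qed
  moreover have "S x" if "int h dvd x" for x
    using that mult by (auto simp: dvd_def mult.commute)
  ultimately show ?thesis by blast
qed

text \<open>
  Stacked bases: a functional \<open>(u, v)\<close> and a vector of the subgroup are chosen so that the value
  \<open>g\<close> of the former at the latter is as small as possible. By minimality \<open>g\<close> divides the vector,
  which is thus \<open>g\<close> times some \<open>(w, z)\<close>, and \<open>(w, z)\<close>, \<open>(- v, u)\<close> is the desired basis of the plane.
\<close>

lemma int_plane_subgroup_stacked_bases:
  fixes S :: "int \<Rightarrow> int \<Rightarrow> bool"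
  assumes zero: "S 0 0"
    and diff: "\<And>x y x' y'. S x y \<Longrightarrow> S x' y' \<Longrightarrow> S (x - x') (y - y')"
  shows "\<exists>u v w z (g::nat) (h::nat). u * w + v * z = 1 \<and>
    (\<forall>x y. S x y \<longleftrightarrow> int g dvd u * x + v * y \<and> int h dvd w * y - z * x)"
proof (cases "\<exists>x y. S x y \<and> (x, y) \<noteq> (0, 0)")
  case False
  \<comment> \<open>For the zero subgroup both moduli have to be 0.\<close>
  then show ?thesis using zero
    by (intro exI[of _ 1] exI[of _ 0]) auto
next
  case True
  define P where "P n \<longleftrightarrow> n > 0 \<and> (\<exists>u v x y. S x y \<and> u * x + v * y = int n)" for n
  obtain x y where xy: "S x y" "(x, y) \<noteq> (0, 0)" using True by blast
  \<comment> \<open>A nonzero member paired with itself gives a positive value, so some number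
    satisfies \<open>P\<close>.\<close>
  have pos: "x * x + y * y > 0" using xy(2) by (auto simp: sum_squares_gt_zero_iff)
  have "S x y \<and> x * x + y * y = int (nat (x * x + y * y))" using xy(1) pos by simp
  then have "P (nat (x * x + y * y))" unfolding P_def using pos zero_less_nat_eq by blast
  define g where "g = (LEAST n. P n)"
  have "P g" unfolding g_def by (rule LeastI) fact
  have least: "g \<le> n" if "P n" for n unfolding g_def by (rule Least_le) fact
  obtain u v x0 y0 where g: "g > 0" "S x0 y0" "u * x0 + v * y0 = int g"
    using \<open>P g\<close> by (auto simp: P_def)
  have add: "S (x + x') (y + y')" if "S x y" "S x' y'" for x y x' y'
    using diff[OF that(1) diff[OF zero that(2)]] by simp
  have nat_mult: "S (int n * x) (int n * y)" if "S x y" for n x y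
    by (induction n) (auto simp: zero algebra_simps intro: add that)
  have mult: "S (n * x) (n * y)" if "S x y" for n x y
    using nat_mult[OF that, of "nat n"] diff[OF zero nat_mult[OF that, of "nat (- n)"]]
    by (cases "n \<ge> 0") auto
  \<comment> \<open>Minimality of \<open>g\<close> for an arbitrary functional and an arbitrary
    member: it is applied first with the functional varied, then with the vector varied.\<close>
  have small: "r = 0" if "0 \<le> r" "r < int g" "S x y" "u * x + v * y = r" for r u v x y
  proof (rule ccontr)
    assume "r \<noteq> 0"
    with that have "nat r > 0" "S x y \<and> u * x + v * y = int (nat r)" by auto
    then have "P (nat r)" unfolding P_def by blast
    from least[OF this] that show False by linarith
  qed
  have dvd_fun: "int g dvd u' * x0 + v' * y0" for u' v'
  proof -
    let ?q = "(u' * x0 + v' * y0) div int g"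
    have "(u' - ?q * u) * x0 + (v' - ?q * v) * y0 = u' * x0 + v' * y0 - ?q * (u * x0 + v * y0)"
      by (simp add: algebra_simps)
    also have "\<dots> = (u' * x0 + v' * y0) mod int g" by (simp add: g minus_div_mult_eq_mod)
    finally have "(u' * x0 + v' * y0) mod int g = 0"
      using g by (intro small[OF _ _ g(2)]) auto
    then show ?thesis by (simp add: dvd_eq_mod_eq_0)
  qed
  have dvd_vec: "int g dvd u * x + v * y" if "S x y" for x y
  proof -
    let ?q = "(u * x + v * y) div int g"
    have "u * (x - ?q * x0) + v * (y - ?q * y0) = u * x + v * y - ?q * (u * x0 + v * y0)"
      by (simp add: algebra_simps)
    also have "\<dots> = (u * x + v * y) mod int g" by (simp add: g minus_div_mult_eq_mod)
    finally have "(u * x + v * y) mod int g = 0"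
      using g by (intro small[OF _ _ diff[OF that mult[OF g(2)]]]) auto
    then show ?thesis by (simp add: dvd_eq_mod_eq_0)
  qed
  obtain w z where wz: "x0 = int g * w" "y0 = int g * z"
    using dvd_fun[of 1 0] dvd_fun[of 0 1] by (auto simp: dvd_def)
  have "int g * (u * w + v * z) = int g * 1" using g(3) by (simp add: wz algebra_simps)
  then have unimod: "u * w + v * z = 1" using g(1) by (simp only: mult_cancel_left) simp
  \<comment> \<open>The second modulus comes from the members on the line where the functional
    \<open>(u, v)\<close> vanishes.\<close>
  obtain h :: nat where h: "\<And>n. S (n * - v) (n * u) \<longleftrightarrow> int h dvd n"
  proof -
    have "\<exists>h::nat. \<forall>n. S (n * - v) (n * u) \<longleftrightarrow> int h dvd n"
    proof (rule int_subgroup_multiples)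
      fix n n' assume "S (n * - v) (n * u)" "S (n' * - v) (n' * u)"
      from diff[OF this] show "S ((n - n') * - v) ((n - n') * u)" by (simp add: algebra_simps)
    qed (use zero in simp)
    then show ?thesis using that by blast
  qed
  \<comment> \<open>Coordinates with respect to \<open>(w, z)\<close> and \<open>(- v, u)\<close>, a
    basis because the determinant is \<open>u * w + v * z = 1\<close>.\<close>
  have decomp: "x = (u * x + v * y) * w + (w * y - z * x) * - v"
    "y = (u * x + v * y) * z + (w * y - z * x) * u" for x y
  proof -
    have "x = x * (u * w + v * z)" "y = y * (u * w + v * z)" by (simp_all add: unimod)
    then show "x = (u * x + v * y) * w + (w * y - z * x) * - v"
      "y = (u * x + v * y) * z + (w * y - z * x) * u" by (simp_all add: algebra_simps)
  qed
  have multiple: "S (n * w) (n * z)" if dvd: "int g dvd n" for n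
  proof -
    obtain m where m: "n = int g * m" using dvd by (auto simp: dvd_def)
    show ?thesis using mult[OF g(2), of m] by (simp add: m wz algebra_simps)
  qed
  have "S x y \<longleftrightarrow> int g dvd u * x + v * y \<and> int h dvd w * y - z * x" for x y
  proof
    assume S: "S x y"
    let ?p = "u * x + v * y"
    have "S (x - ?p * w) (y - ?p * z)" by (rule diff[OF S multiple[OF dvd_vec[OF S]]])
    moreover have "x - ?p * w = (w * y - z * x) * - v" "y - ?p * z = (w * y - z * x) * u"
      using decomp[where x = x and y = y] by linarith+
    ultimately show "int g dvd u * x + v * y \<and> int h dvd w * y - z * x"
      using dvd_vec[OF S] h by auto
  next
    assume a: "int g dvd u * x + v * y \<and> int h dvd w * y - z * x"
    then have "S ((u * x + v * y) * w + (w * y - z * x) * - v)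
        ((u * x + v * y) * z + (w * y - z * x) * u)"
      using h by (intro add multiple) auto
    then show "S x y" using decomp[where x = x and y = y] by simp
  qed
  with unimod show ?thesis by blast
qed

lemma cyclic_integer_mod_group: "cyclic_group (integer_mod_group n)"
proof -
  \<comment> \<open>The generator is \<open>1 mod int n\<close> and not 1, which lies outside the
    carrier when \<open>n = 1\<close>.\<close>
  have "x \<in> range (\<lambda>i. i * (1 mod int n) mod int n)" if "x \<in> carrier (integer_mod_group n)" for x
    using that
    by (intro image_eqI[of _ _ x]) (auto simp: carrier_integer_mod_group mod_mult_right_eq split: if_splits)
  moreover have "i mod int n \<in> carrier (integer_mod_group n)" for i
    by (simp add: carrier_integer_mod_group)
  ultimately show ?thesis
    unfolding group.cyclic_group[OF group_integer_mod_group] int_pow_integer_mod_group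
    by (intro bexI[of _ "1 mod int n"]) auto
qed

section \<open>The dollar game on an Eulerian cone\<close>

text \<open>These are the features of a wheel on which the general argument rests. The rim is
  balanced, and every rim vertex has \<open>t\<close> arcs leaving the rim and \<open>t\<close> arcs
  from the bank; so firing the whole rim once cancels a firing of the bank.\<close>

locale eulerian_cone =
  fixes G :: "('a, 'b) pre_digraph" and b :: 'a and t :: nat
  assumes finite_verts: "finite (verts G)"
    and bank_in_verts: "b \<in> verts G"
    and t_pos: "t > 0"
    and out_degree_eq: "v \<in> verts G - {b} \<Longrightarrow>
      out_degree G v = t + (\<Sum>w\<in>verts G - {b}. mult_arcs G v w)"
    and eulerian: "v \<in> verts G - {b} \<Longrightarrow>
      (\<Sum>u\<in>verts G - {b}. mult_arcs G u v) = (\<Sum>w\<in>verts G - {b}. mult_arcs G v w)"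
    and mult_arcs_bank: "v \<in> verts G - {b} \<Longrightarrow> mult_arcs G b v = t"
begin

abbreviation "rim \<equiv> verts G - {b}"
abbreviation "m \<equiv> mult_arcs G"
abbreviation "deg \<equiv> out_degree G"

declare finite_verts [simp]

lemma out_degree_eq': "v \<in> rim \<Longrightarrow> deg v = t + (\<Sum>u\<in>rim. m u v)"
  using out_degree_eq eulerian by simp

lemma fire_rim:
  assumes "u \<in> rim" "deg u \<le> c u" "v \<in> rim"
  shows "fire G b u c v + (if v = u then deg u else 0) = c v + m u v"
  using assms by (auto simp: fire_def)

lemma fire_bank: "v \<in> rim \<Longrightarrow> fire G b b c v = c v + t"
  by (auto simp: fire_def mult_arcs_bank)

lemma configuration_fire: "configuration G b (fire G b u c)"
  by (simp add: configuration_def fire_def)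

lemma game_step_cases:
  assumes "game_step G b c d"
  obtains (rim) u where "u \<in> rim" "deg u \<le> c u" "d = fire G b u c"
    | (bank) "d = fire G b b c"
  using assms by (auto simp: game_step_def can_fire_def split: if_splits)

lemma sum_fire_rim:
  assumes "u \<in> rim" "deg u \<le> c u"
  shows "sum (fire G b u c) rim + t = sum c rim"
proof -
  have "(\<Sum>v\<in>rim. fire G b u c v + (if v = u then deg u else 0)) = (\<Sum>v\<in>rim. c v + m u v)"
    by (intro sum.cong refl fire_rim assms)
  then have "sum (fire G b u c) rim + deg u = sum c rim + (\<Sum>v\<in>rim. m u v)"
    using assms by (simp add: sum.distrib)
  with out_degree_eq[OF assms(1)] show ?thesis by simp
qed

section \<open>Stabilization and existence of critical configurations\<close>

lemma reach_stable:
  assumes "configuration G b c"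
  shows "\<exists>d. configuration G b d \<and> stable G b d \<and> (game_step G b)\<^sup>*\<^sup>* c d"
  using assms
proof (induction "sum c rim" arbitrary: c rule: less_induct)
  case less
  show ?case
  proof (cases "stable G b c")
    case True
    with less.prems show ?thesis by blast
  next
    case False
    then obtain u where u: "u \<in> rim" "deg u \<le> c u"
      by (auto simp: stable_def not_less)
    have step: "game_step G b c (fire G b u c)"
      using u by (auto simp: game_step_def can_fire_def)
    have "sum (fire G b u c) rim < sum c rim"
      using sum_fire_rim[of u c, OF u] t_pos by linarith
    from less.hyps[OF this configuration_fire] show ?thesis
      using converse_rtranclp_into_rtranclp[of "game_step G b", OF step] by blast
  qed
qed

lemma finite_stable: "finite {c. configuration G b c \<and> stable G b c}"
proof (rule finite_subset)
  show "{c. configuration G b c \<and> stable G b c} \<subseteq>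
    {c. \<forall>v. (v \<in> rim \<longrightarrow> c v \<in> (\<Union>v\<in>rim. {..<deg v})) \<and> (v \<notin> rim \<longrightarrow> c v = 0)}"
    by (auto simp: configuration_def stable_def)
  show "finite {c. \<forall>v. (v \<in> rim \<longrightarrow> c v \<in> (\<Union>v\<in>rim. {..<deg v})) \<and> (v \<notin> rim \<longrightarrow> c v = 0)}"
    by (rule finite_set_of_finite_funs) auto
qed

lemma stable_step:
  assumes "stable G b c"
  shows "\<exists>d. configuration G b d \<and> stable G b d \<and> (game_step G b)\<^sup>+\<^sup>+ c d"
proof -
  have "game_step G b c (fire G b b c)"
    using assms bank_in_verts by (auto simp: game_step_def can_fire_def)
  with reach_stable[OF configuration_fire, of b c] show ?thesis
    by (blast intro: rtranclp_into_tranclp2)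
qed

text \<open>Firing the bank and stabilizing again is a self-map of the finite set of stable
  configurations. Its orbits repeat, and a repeated configuration is recurrent.\<close>

lemma reach_critical:
  assumes "configuration G b c"
  shows "\<exists>d. critical G b d \<and> (game_step G b)\<^sup>*\<^sup>* c d"
proof -
  let ?S = "{c. configuration G b c \<and> stable G b c}"
  obtain s where s: "s \<in> ?S" "(game_step G b)\<^sup>*\<^sup>* c s"
    using reach_stable[OF assms] by blast
  obtain f where f: "\<And>c. c \<in> ?S \<Longrightarrow> f c \<in> ?S \<and> (game_step G b)\<^sup>+\<^sup>+ c (f c)"
    using stable_step by (metis (mono_tags, lifting) mem_Collect_eq)
  have in_S: "(f ^^ n) x \<in> ?S" if "x \<in> ?S" for n x
    using that f by (induction n) auto
  \<comment> \<open>The exponent is a successor because recurrence asks for a cycle with at least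
    one move.\<close>
  have path: "(game_step G b)\<^sup>+\<^sup>+ x ((f ^^ Suc n) x)" if "x \<in> ?S" for n x
  proof (induction n)
    case 0
    then show ?case using f that by simp
  next
    case (Suc n)
    moreover have "(game_step G b)\<^sup>+\<^sup>+ ((f ^^ Suc n) x) (f ((f ^^ Suc n) x))"
      using f in_S that by blast
    ultimately show ?case by (auto intro: tranclp_trans)
  qed
  have "\<not> inj (\<lambda>n. (f ^^ n) s)"
  proof
    assume "inj (\<lambda>n. (f ^^ n) s)"
    moreover have "finite (range (\<lambda>n. (f ^^ n) s))"
      using in_S[OF s(1)] by (intro finite_subset[OF _ finite_stable]) auto
    ultimately show False using finite_imageD infinite_UNIV_nat by blast
  qed
  then obtain i j where ij: "i < j" "(f ^^ i) s = (f ^^ j) s"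
    unfolding inj_def by (metis linorder_neqE_nat)
  obtain n where n: "j = Suc n + i" using less_imp_Suc_add[OF ij(1)] by auto
  let ?d = "(f ^^ i) s"
  have "(f ^^ Suc n) ?d = ?d" using ij(2) unfolding n funpow_add by simp
  then have "recurrent G b ?d" unfolding recurrent_def
    using path[OF in_S[OF s(1)], of i n] by simp
  then have "critical G b ?d" using in_S[OF s(1), of i] by (simp add: critical_def)
  moreover have "(game_step G b)\<^sup>*\<^sup>* s ?d"
    using path[OF s(1)] by (cases i) (auto intro: tranclp_into_rtranclp simp del: funpow.simps(2))
  ultimately show ?thesis using s(2) by (meson rtranclp_trans)
qed

subsection \<open>The Laplacian lattice\<close>

text \<open>The image of the transposed reduced Laplacian: \<open>x v\<close> is the net number of
  firings of \<open>v\<close>, and \<open>f\<close> is the resulting loss. Values off the rim are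
  ignored, so functions need no normalization there.\<close>

definition in_lattice :: "('a \<Rightarrow> int) \<Rightarrow> bool" where
  "in_lattice f \<longleftrightarrow> (\<exists>x. \<forall>v\<in>rim. f v = int (deg v) * x v - (\<Sum>u\<in>rim. int (m u v) * x u))"

lemma lattice_cong:
  assumes "\<forall>v\<in>rim. f v = g v"
  shows "in_lattice f \<longleftrightarrow> in_lattice g"
  using assms by (simp add: in_lattice_def)

lemma lattice_0 [simp]: "in_lattice (\<lambda>_. 0)"
  unfolding in_lattice_def by (rule exI[of _ "\<lambda>_. 0"]) simp

lemma lattice_combination:
  assumes "in_lattice f" "in_lattice g"
  shows "in_lattice (\<lambda>v. i * f v + j * g v)"
proof -
  obtain x y where
    "\<forall>v\<in>rim. f v = int (deg v) * x v - (\<Sum>u\<in>rim. int (m u v) * x u)"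
    "\<forall>v\<in>rim. g v = int (deg v) * y v - (\<Sum>u\<in>rim. int (m u v) * y u)"
    using assms by (auto simp: in_lattice_def)
  then have "i * f v + j * g v = int (deg v) * (i * x v + j * y v)
      - (\<Sum>u\<in>rim. int (m u v) * (i * x u + j * y u))" if "v \<in> rim" for v
    using that
    by (simp add: right_diff_distrib distrib_left sum.distrib sum_distrib_left mult.left_commute)
  then show ?thesis unfolding in_lattice_def
    by (intro exI[of _ "\<lambda>v. i * x v + j * y v"] ballI)
qed

lemma lattice_add: "in_lattice f \<Longrightarrow> in_lattice g \<Longrightarrow> in_lattice (\<lambda>v. f v + g v)"
  using lattice_combination[of f g 1 1] by simp

lemma lattice_diff: "in_lattice f \<Longrightarrow> in_lattice g \<Longrightarrow> in_lattice (\<lambda>v. f v - g v)"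
  using lattice_combination[of f g 1 "-1"] by simp

lemma lattice_mult: "in_lattice f \<Longrightarrow> in_lattice (\<lambda>v. i * f v)"
  using lattice_combination[of f "\<lambda>_. 0" i 0] by simp

lemma lattice_sum:
  "finite A \<Longrightarrow> (\<And>i. i \<in> A \<Longrightarrow> in_lattice (f i)) \<Longrightarrow> in_lattice (\<lambda>v. \<Sum>i\<in>A. f i v)"
  by (induction A rule: finite_induct) (auto intro: lattice_add)

lemma lattice_firing:
  assumes "u \<in> rim"
  shows "in_lattice (\<lambda>v. (if v = u then int (deg u) else 0) - int (m u v))"
  unfolding in_lattice_def using assms
  by (intro exI[of _ "\<lambda>v. if v = u then 1 else 0"])
    (auto simp: if_distrib[of "\<lambda>x. _ * x"] cong: if_cong)

text \<open>When every rim vertex fires once, the balanced arcs inside the rim cancel and each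
  vertex loses \<open>t\<close>. This places bank firings in the lattice and later allows shifts to
  nonnegative values.\<close>

lemma lattice_constant: "in_lattice (\<lambda>_. int t)"
  unfolding in_lattice_def
  by (intro exI[of _ "\<lambda>_. 1"]) (simp add: out_degree_eq' del: Diff_iff)

lemma lattice_step:
  assumes "game_step G b c d"
  shows "in_lattice (\<lambda>v. int (c v) - int (d v))"
  using assms
proof (cases rule: game_step_cases)
  case (rim u)
  have "int (c v) - int (d v) = (if v = u then int (deg u) else 0) - int (m u v)" if "v \<in> rim" for v
    using fire_rim[of u c v, OF rim(1,2) that] by (simp add: rim(3) split: if_splits)
  then have "\<forall>v\<in>rim. int (c v) - int (d v) = (if v = u then int (deg u) else 0) - int (m u v)" ..
  from lattice_cong[OF this] lattice_firing[OF rim(1)] show ?thesis by simp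
next
  case bank
  have "int (c v) - int (d v) = - 1 * int t" if "v \<in> rim" for v
    using fire_bank[OF that] by (simp add: bank)
  then have "\<forall>v\<in>rim. int (c v) - int (d v) = - 1 * int t" ..
  from lattice_cong[OF this] lattice_mult[OF lattice_constant, of "-1"] show ?thesis by simp
qed

lemma lattice_reach:
  "(game_step G b)\<^sup>*\<^sup>* c d \<Longrightarrow> in_lattice (\<lambda>v. int (c v) - int (d v))"
proof (induction rule: rtranclp_induct)
  case (step d e)
  from lattice_add[OF step.IH lattice_step[OF step.hyps(2)]] show ?case by simp
qed simp

subsection \<open>Uniqueness of critical configurations\<close>

text \<open>A configuration is free on \<open>U\<close> if no nonempty subset of \<open>U\<close> is forbidden in Dhar's sense.\<close>

definition free_on :: "('a \<Rightarrow> nat) \<Rightarrow> 'a set \<Rightarrow> bool" where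
  "free_on c U \<longleftrightarrow> (\<forall>F\<subseteq>U. F \<noteq> {} \<longrightarrow> (\<exists>v\<in>F. (\<Sum>u\<in>F. m u v) \<le> c v))"

lemma free_on_mono:
  assumes "free_on c U" "\<And>v. v \<in> U \<Longrightarrow> c v \<le> d v"
  shows "free_on d U"
  unfolding free_on_def
proof (intro allI impI)
  fix F assume F: "F \<subseteq> U" "F \<noteq> {}"
  then obtain v where "v \<in> F" "(\<Sum>u\<in>F. m u v) \<le> c v"
    using assms(1) unfolding free_on_def by blast
  with F assms(2)[of v] show "\<exists>v\<in>F. (\<Sum>u\<in>F. m u v) \<le> d v" by (intro bexI[of _ v]) auto
qed

text \<open>For a test set containing \<open>w\<close>, a good vertex of the set without
  \<open>w\<close> stays good: the firing pays it \<open>m w v\<close>, exactly the new summand. For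
  the singleton of \<open>w\<close>, the loops at \<open>w\<close> return enough.\<close>

lemma free_on_fire:
  assumes "free_on c U" "U \<subseteq> rim" and w: "w \<in> rim" "deg w \<le> c w"
  shows "free_on (fire G b w c) (insert w U)"
  unfolding free_on_def
proof (intro allI impI)
  fix F assume F: "F \<subseteq> insert w U" "F \<noteq> {}"
  let ?d = "fire G b w c"
  have finF: "finite F" using F assms by (meson finite_verts finite_Diff finite_subset insert_subset)
  have dv: "?d v = c v + m w v" if "v \<in> U" "v \<noteq> w" for v
    using fire_rim[of w c v, OF w] that assms(2) by auto
  have dw: "m w w \<le> ?d w"
    using fire_rim[of w c w, OF w w(1)] w(2) by simp
  show "\<exists>v\<in>F. (\<Sum>u\<in>F. m u v) \<le> ?d v"
  proof (cases "F - {w} = {}")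
    case True
    with F have "F = {w}" by blast
    with dw show ?thesis by simp
  next
    case False
    moreover have "F - {w} \<subseteq> U" using F by blast
    ultimately obtain v where v: "v \<in> F - {w}" "(\<Sum>u\<in>F - {w}. m u v) \<le> c v"
      using assms(1) unfolding free_on_def by blast
    have "(\<Sum>u\<in>F. m u v) \<le> m w v + (\<Sum>u\<in>F - {w}. m u v)"
      using finF by (cases "w \<in> F") (auto simp: sum.remove)
    also have "\<dots> \<le> ?d v" using v dv[of v] F by auto
    finally show ?thesis using v by blast
  qed
qed

text \<open>
  The set \<open>U\<close> collects the rim vertices that have fired. In a cycle of the game it is the whole rim:
  a vertex that never fires never loses money, so the bank does not fire either, and then the total
  decreases with every move.
\<close>

lemma game_step_invariant:
  assumes step: "game_step G b d e"
    and U: "U \<subseteq> rim" "free_on d U"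
    and inv: "(\<forall>v\<in>rim - U. c v + t \<le> d v) \<or> (\<forall>v\<in>rim - U. c v \<le> d v) \<and> sum d rim \<le> sum c rim"
  shows "\<exists>U\<subseteq>rim. free_on e U \<and>
    ((\<forall>v\<in>rim - U. c v + t \<le> e v) \<or> (\<forall>v\<in>rim - U. c v \<le> e v) \<and> sum e rim < sum c rim)"
  using step
proof (cases rule: game_step_cases)
  case (rim w)
  have le: "d v \<le> e v" if "v \<in> rim - insert w U" for v
    using fire_rim[of w d v, OF rim(1,2)] that rim(3) by auto
  have lt: "sum e rim < sum d rim"
    using sum_fire_rim[of w d, OF rim(1,2)] rim(3) t_pos by simp
  show ?thesis
  proof (intro exI[of _ "insert w U"] conjI)
    show "insert w U \<subseteq> rim" using U rim by blast
    show "free_on e (insert w U)" using free_on_fire[OF U(2,1) rim(1,2)] rim(3) by simp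
    show "(\<forall>v\<in>rim - insert w U. c v + t \<le> e v) \<or>
      (\<forall>v\<in>rim - insert w U. c v \<le> e v) \<and> sum e rim < sum c rim"
      using inv
    proof (elim disjE conjE)
      assume "\<forall>v\<in>rim - U. c v + t \<le> d v"
      then have "c v + t \<le> e v" if "v \<in> rim - insert w U" for v
        using le[OF that] that by force
      then show ?thesis by blast
    next
      assume a: "\<forall>v\<in>rim - U. c v \<le> d v" "sum d rim \<le> sum c rim"
      then have "c v \<le> e v" if "v \<in> rim - insert w U" for v
        using le[OF that] that by force
      then show ?thesis using lt a(2) by auto
    qed
  qed
next
  case bank
  have e: "e v = d v + t" if "v \<in> rim" for v using fire_bank[OF that] bank by simp
  have "free_on e U" using U(1) e by (intro free_on_mono[OF U(2)]) (metis le_add1 subsetD)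
  \<comment> \<open>A bank firing leads from either alternative to the first one.\<close>
  moreover have "c v + t \<le> e v" if "v \<in> rim - U" for v
  proof -
    have "v \<in> rim" using that by blast
    from e[OF this] inv that show ?thesis by force
  qed
  ultimately show ?thesis using U(1) by blast
qed

lemma recurrent_free_on:
  assumes "recurrent G b c"
  shows "free_on c rim"
proof -
  have "\<exists>U\<subseteq>rim. free_on d U \<and>
      ((\<forall>v\<in>rim - U. c v + t \<le> d v) \<or> (\<forall>v\<in>rim - U. c v \<le> d v) \<and> sum d rim < sum c rim)"
    if "(game_step G b)\<^sup>+\<^sup>+ c d" for d
    using that
  proof (induction rule: tranclp_induct)
    \<comment> \<open>At the start of the cycle nothing has fired and the totals are equal, whence
      the weak inequality in the hypothesis of \<open>game_step_invariant\<close>; one move makes it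
      strict.\<close>
    case (base d)
    then show ?case
      by (rule game_step_invariant[where U = "{}"]) (auto simp: free_on_def)
  next
    case (step d e)
    from step.IH obtain U where U: "U \<subseteq> rim" "free_on d U"
      "(\<forall>v\<in>rim - U. c v + t \<le> d v) \<or> (\<forall>v\<in>rim - U. c v \<le> d v) \<and> sum d rim < sum c rim"
      by blast
    show ?case
      by (rule game_step_invariant[OF step.hyps(2) U(1,2)]) (use U(3) in auto)
  qed
  \<comment> \<open>When the cycle closes, the second alternative would make the total smaller than
    itself. The first leaves no vertex outside \<open>U\<close>, as \<open>t\<close> is
    positive.\<close>
  from this[of c] assms obtain U where U: "U \<subseteq> rim" "free_on c U" "\<forall>v\<in>rim - U. c v + t \<le> c v"
    by (auto simp: recurrent_def)
  then have "U = rim" using t_pos by fastforce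
  with U show ?thesis by simp
qed

text \<open>
  If \<open>c\<close> arises from \<open>d\<close> by firing the vertices according to \<open>x\<close>, then the set where \<open>x\<close> attains a
  positive maximum is forbidden in \<open>c\<close>.
\<close>

lemma firing_vector_nonpos:
  assumes d: "stable G b d" and c: "free_on c rim"
    and x: "\<forall>v\<in>rim. int (d v) - int (c v) = int (deg v) * x v - (\<Sum>u\<in>rim. int (m u v) * x u)"
    and v: "v \<in> rim"
  shows "x v \<le> 0"
proof (rule ccontr)
  define M where "M = Max (x ` rim)"
  define F where "F = {v \<in> rim. x v = M}"
  assume "\<not> x v \<le> 0"
  moreover have le_M: "x u \<le> M" if "u \<in> rim" for u
    unfolding M_def using that by (intro Max_ge) auto
  ultimately have M: "M \<ge> 1" using v by force
  have "M \<in> x ` rim" unfolding M_def using v by (intro Max_in) auto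
  then have "F \<noteq> {}" "F \<subseteq> rim" by (auto simp: F_def)
  then obtain w where w: "w \<in> F" "(\<Sum>u\<in>F. m u w) \<le> c w"
    using c unfolding free_on_def by blast
  have wr: "w \<in> rim" "x w = M" using w by (auto simp: F_def)
  have split: "(\<Sum>u\<in>rim. f u) = (\<Sum>u\<in>F. f u) + (\<Sum>u\<in>rim - F. f u)" for f :: "'a \<Rightarrow> int"
    using sum.subset_diff[OF \<open>F \<subseteq> rim\<close>] by (simp add: add.commute)
  \<comment> \<open>Outside \<open>F\<close> the integer \<open>x u\<close> is at most
    \<open>M - 1\<close>; this gap supplies the term \<open>- B\<close> below.\<close>
  have "(\<Sum>u\<in>rim - F. int (m u w) * x u) \<le> (\<Sum>u\<in>rim - F. int (m u w) * (M - 1))"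
  proof (intro sum_mono mult_left_mono)
    fix u assume "u \<in> rim - F"
    then show "x u \<le> M - 1" using le_M[of u] by (force simp: F_def)
  qed auto
  also have "\<dots> = (\<Sum>u\<in>rim - F. int (m u w)) * (M - 1)" by (simp add: sum_distrib_right)
  finally have out: "(\<Sum>u\<in>rim - F. int (m u w) * x u) \<le> (\<Sum>u\<in>rim - F. int (m u w)) * (M - 1)" .
  have inside: "(\<Sum>u\<in>F. int (m u w) * x u) = (\<Sum>u\<in>F. int (m u w)) * M"
    by (simp add: sum_distrib_right F_def)
  \<comment> \<open>The arcs into \<open>w\<close> from \<open>F\<close> and from the rest of the
    rim. By balance they account for \<open>deg w\<close> up to \<open>t\<close>, and the goal is
    \<open>c w < A\<close>, against the choice of \<open>w\<close>.\<close>
  define A B where "A = (\<Sum>u\<in>F. int (m u w))" and "B = (\<Sum>u\<in>rim - F. int (m u w))"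
  have deg: "int (deg w) = int t + A + B"
    using out_degree_eq'[OF wr(1)] split[of "\<lambda>u. int (m u w)"] by (simp add: A_def B_def)
  have "int (c w) = int (d w) - int (deg w) * M + (\<Sum>u\<in>rim. int (m u w) * x u)"
    using x wr by (force simp: wr(2))
  also have "\<dots> \<le> int (d w) - (int t + A + B) * M + A * M + B * (M - 1)"
    using out inside split[of "\<lambda>u. int (m u w) * x u"] by (simp add: deg A_def B_def)
  also have "\<dots> = int (d w) - int t * M - B" by (simp add: algebra_simps)
  also have "\<dots> < A + int t * (1 - M)"
  proof -
    have "d w < deg w" using d wr(1) by (simp add: stable_def)
    then have "int (d w) < int t + A + B" using deg by linarith
    then show ?thesis by (simp add: algebra_simps)
  qed
  also have "\<dots> \<le> A" using M by (simp add: mult_le_0_iff)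
  finally show False using w(2) by (simp add: A_def flip: of_nat_sum)
qed

text \<open>Both configurations are stable and free, so \<open>firing_vector_nonpos\<close> applies
  to \<open>x\<close> and to \<open>- x\<close>.\<close>

lemma critical_unique:
  assumes c: "critical G b c" and d: "critical G b d"
    and lat: "in_lattice (\<lambda>v. int (c v) - int (d v))"
  shows "c = d"
proof -
  from lat obtain x where
    x: "\<forall>v\<in>rim. int (c v) - int (d v) = int (deg v) * x v - (\<Sum>u\<in>rim. int (m u v) * x u)"
    by (auto simp: in_lattice_def)
  then have x': "\<forall>v\<in>rim. int (d v) - int (c v) = int (deg v) * (- x v) - (\<Sum>u\<in>rim. int (m u v) * (- x u))"
    by (force simp: sum_negf)
  have "x v \<le> 0" "- x v \<le> 0" if "v \<in> rim" for v
    using firing_vector_nonpos[OF _ _ x that] firing_vector_nonpos[OF _ _ x' that] c d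
    by (auto simp: critical_def recurrent_free_on)
  then have "\<forall>v\<in>rim. x v = 0" by force
  with x have "c v = d v" if "v \<in> rim" for v using that by simp
  moreover have "c v = d v" if "v \<notin> rim" for v
    using that c d by (auto simp: critical_def configuration_def)
  ultimately show ?thesis by blast
qed

subsection \<open>The critical group as a quotient lattice\<close>

text \<open>Two critical configurations reached from \<open>c\<close> differ by a lattice vector and
  hence coincide, so the definite description is meaningful.\<close>

lemma critical_of:
  assumes "configuration G b c"
  shows "critical G b (critical_of G b c)"
    and "in_lattice (\<lambda>v. int (c v) - int (critical_of G b c v))"
proof -
  have "\<exists>!d. critical G b d \<and> (game_step G b)\<^sup>*\<^sup>* c d"
  proof (rule ex_ex1I[OF reach_critical[OF assms]])
    fix d e
    assume d: "critical G b d \<and> (game_step G b)\<^sup>*\<^sup>* c d" and e: "critical G b e \<and> (game_step G b)\<^sup>*\<^sup>* c e"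
    then have "in_lattice (\<lambda>v. (int (c v) - int (e v)) - (int (c v) - int (d v)))"
      by (intro lattice_diff lattice_reach) auto
    with d e show "d = e" by (intro critical_unique) auto
  qed
  from theI'[OF this] show "critical G b (critical_of G b c)"
    and "in_lattice (\<lambda>v. int (c v) - int (critical_of G b c v))"
    by (auto simp: critical_of_def intro: lattice_reach)
qed

text \<open>\<open>\<Phi>\<close> plays the role of the quotient map by the lattice. Each coset
  contains exactly one critical configuration, so \<open>\<Phi>\<close> is bijective on these, and
  the group laws are carried over from \<open>H\<close>.\<close>

lemma critical_group_iso:
  fixes H :: "('c, 'd) monoid_scheme"
  assumes H: "group H"
    and closed: "\<And>f. \<Phi> f \<in> carrier H"
    and add: "\<And>f g. \<Phi> (\<lambda>v. f v + g v) = \<Phi> f \<otimes>\<^bsub>H\<^esub> \<Phi> g"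
    and kernel: "\<And>f. \<Phi> f = \<one>\<^bsub>H\<^esub> \<longleftrightarrow> in_lattice f"
    and surj: "carrier H \<subseteq> range \<Phi>"
  shows "group (critical_group G b) \<and> critical_group G b \<cong> H"
proof -
  interpret H: group H by fact
  let ?K = "critical_group G b"
  let ?h = "\<lambda>c. \<Phi> (\<lambda>v. int (c v))"
  have eq_iff: "\<Phi> f = \<Phi> g \<longleftrightarrow> in_lattice (\<lambda>v. f v - g v)" for f g
  proof -
    have "\<Phi> f = \<Phi> (\<lambda>v. f v - g v) \<otimes>\<^bsub>H\<^esub> \<Phi> g"
      using add[of "\<lambda>v. f v - g v" g] by simp
    then have "\<Phi> f = \<Phi> g \<longleftrightarrow> \<Phi> (\<lambda>v. f v - g v) = \<one>\<^bsub>H\<^esub>"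
      using closed by simp
    with kernel show ?thesis by simp
  qed
  have h_critical_of: "?h (critical_of G b c) = ?h c" if "configuration G b c" for c
    by (rule eq_iff[THEN iffD2, OF critical_of(2)[OF that], symmetric])
  have conf: "configuration G b (\<lambda>_. 0)" by (simp add: configuration_def)
  have "?h \<in> hom ?K H"
  proof (rule homI)
    fix c d assume "c \<in> carrier ?K" "d \<in> carrier ?K"
    then have "configuration G b (\<lambda>v. c v + d v)"
      by (simp add: critical_group_def critical_def configuration_def)
    from h_critical_of[OF this] show "?h (c \<otimes>\<^bsub>?K\<^esub> d) = ?h c \<otimes>\<^bsub>H\<^esub> ?h d"
      by (simp add: critical_group_def flip: add)
  qed (rule closed)
  moreover have "bij_betw ?h (carrier ?K) (carrier H)"
    unfolding bij_betw_def
  proof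
    show "inj_on ?h (carrier ?K)"
      by (rule inj_onI) (auto simp: critical_group_def eq_iff intro: critical_unique)
    show "?h ` carrier ?K = carrier H"
    proof
      show "?h ` carrier ?K \<subseteq> carrier H" using closed by blast
      show "carrier H \<subseteq> ?h ` carrier ?K"
      proof
        fix y assume "y \<in> carrier H"
        then obtain f where f: "y = \<Phi> f" using surj by blast
        define N where "N = (\<Sum>v\<in>rim. \<bar>f v\<bar>)"
        \<comment> \<open>Adding a multiple of the constant \<open>t\<close> stays in the coset, and
          the factor \<open>N\<close> is large enough to make all values nonnegative.\<close>
        define c where "c v = (if v \<in> rim then nat (f v + N * int t) else 0)" for v
        have "0 \<le> f v + N * int t" if "v \<in> rim" for v
        proof -
          have N: "\<bar>f v\<bar> \<le> N" unfolding N_def using that by (intro member_le_sum) auto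
          also have "N \<le> N * int t" using t_pos N mult_left_mono[of 1 "int t" N] by simp
          finally show ?thesis by linarith
        qed
        then have "in_lattice (\<lambda>v. int (c v) - f v) \<longleftrightarrow> in_lattice (\<lambda>v. N * int t)"
          by (intro lattice_cong ballI) (simp add: c_def)
        then have "?h c = y" using lattice_mult[OF lattice_constant] by (simp add: f eq_iff)
        moreover have conf: "configuration G b c" by (simp add: configuration_def c_def)
        ultimately have "?h (critical_of G b c) = y" by (simp add: h_critical_of)
        then show "y \<in> ?h ` carrier ?K"
          using critical_of(1)[OF conf] by (auto simp: critical_group_def)
      qed
    qed
  qed
  ultimately have iso: "?h \<in> iso ?K H" by (simp add: iso_def)
  have one: "?h \<one>\<^bsub>?K\<^esub> = \<one>\<^bsub>H\<^esub>" "\<one>\<^bsub>?K\<^esub> \<in> carrier ?K"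
    using h_critical_of[OF conf] kernel critical_of(1)[OF conf] by (simp_all add: critical_group_def)
  let ?g = "inv_into (carrier ?K) ?h"
  have bij: "bij_betw ?h (carrier ?K) (carrier H)" and hom: "?h \<in> hom ?K H"
    using iso by (auto simp: iso_def)
  have closed_mult: "c \<otimes>\<^bsub>?K\<^esub> d \<in> carrier ?K" if "c \<in> carrier ?K" "d \<in> carrier ?K" for c d
  proof -
    have "configuration G b (\<lambda>v. c v + d v)"
      using that by (simp add: critical_group_def critical_def configuration_def)
    from critical_of(1)[OF this] show ?thesis by (simp add: critical_group_def)
  qed
  have inv_iso: "?g \<in> iso H ?K"
  proof (rule isoI)
    show "bij_betw ?g (carrier H) (carrier ?K)" by (rule bij_betw_inv_into[OF bij])
    have g: "?g y \<in> carrier ?K" "?h (?g y) = y" if "y \<in> carrier H" for y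
      using bij_betw_apply[OF bij_betw_inv_into[OF bij] that] bij_betw_inv_into_right[OF bij that]
      by simp_all
    show "?g \<in> hom H ?K"
    proof (rule homI)
      fix y z assume y: "y \<in> carrier H" and z: "z \<in> carrier H"
      have "?h (?g y \<otimes>\<^bsub>?K\<^esub> ?g z) = y \<otimes>\<^bsub>H\<^esub> z"
        using hom_mult[OF hom g(1)[OF y] g(1)[OF z]] g y z by simp
      then show "?g (y \<otimes>\<^bsub>H\<^esub> z) = ?g y \<otimes>\<^bsub>?K\<^esub> ?g z"
        using bij closed_mult[OF g(1)[OF y] g(1)[OF z]] by (intro inv_into_f_eq) (auto simp: bij_betw_def)
    qed (use g in auto)
  qed
  \<comment> \<open>Transport along \<open>?g\<close> gives a group whose unit is the image of the
    unit of \<open>H\<close>; it has to be identified with the unit of \<open>?K\<close>.\<close>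
  have "?g \<one>\<^bsub>H\<^esub> = \<one>\<^bsub>?K\<^esub>"
    using bij one by (intro inv_into_f_eq) (auto simp: bij_betw_def)
  with H.iso_imp_img_group[OF inv_iso] have "group ?K" by simp
  with iso show ?thesis by (auto simp: is_iso_def)
qed

text \<open>Modulo the lattice every function is a combination of the two generators. The relations
  between these form a subgroup of the plane, and coordinates in a stacked basis split the quotient
  into two cyclic factors.\<close>

lemma critical_group_two_generators:
  fixes g\<^sub>1 g\<^sub>2 :: "'a \<Rightarrow> int"
  assumes gen: "\<And>i. i \<in> rim \<Longrightarrow>
    \<exists>x y. in_lattice (\<lambda>v. (if v = i then 1 else 0) - (x * g\<^sub>1 v + y * g\<^sub>2 v))"
  shows "\<exists>n n'. group (critical_group G b) \<and>
    critical_group G b \<cong> integer_mod_group n \<times>\<times> integer_mod_group n'"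
proof -
  define S where "S x y \<longleftrightarrow> in_lattice (\<lambda>v. x * g\<^sub>1 v + y * g\<^sub>2 v)" for x y
  have diff: "S (x - x') (y - y')" if "S x y" "S x' y'" for x y x' y'
    using lattice_diff[OF that[unfolded S_def]] by (simp add: S_def algebra_simps)
  have "S 0 0" by (simp add: S_def)
  from int_plane_subgroup_stacked_bases[of S, OF this diff]
  obtain u v w z and n n' :: nat where unimod: "u * w + v * z = 1"
    and S: "\<And>x y. S x y \<longleftrightarrow> int n dvd u * x + v * y \<and> int n' dvd w * y - z * x"
    by blast
  obtain \<alpha> \<beta> where \<alpha>\<beta>: "\<And>i. i \<in> rim \<Longrightarrow>
    in_lattice (\<lambda>v. (if v = i then 1 else 0) - (\<alpha> i * g\<^sub>1 v + \<beta> i * g\<^sub>2 v))"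
    using gen by metis
  define a c where "a f = (\<Sum>i\<in>rim. f i * \<alpha> i)" and "c f = (\<Sum>i\<in>rim. f i * \<beta> i)" for f
  have reduce: "in_lattice (\<lambda>v. f v - (a f * g\<^sub>1 v + c f * g\<^sub>2 v))" for f
  proof -
    have "in_lattice (\<lambda>v. \<Sum>i\<in>rim. f i * ((if v = i then 1 else 0) - (\<alpha> i * g\<^sub>1 v + \<beta> i * g\<^sub>2 v)))"
      by (intro lattice_sum lattice_mult \<alpha>\<beta>) auto
    also have "?this \<longleftrightarrow> ?thesis"
      by (intro lattice_cong ballI)
        (simp add: a_def c_def right_diff_distrib sum_subtractf sum.distrib sum_distrib_right
          distrib_left mult.assoc if_distrib[of "\<lambda>x. _ * x"] cong: if_cong)
    finally show ?thesis .
  qed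
  have lattice_iff: "in_lattice f \<longleftrightarrow> S (a f) (c f)" for f
  proof
    assume "in_lattice f"
    from lattice_diff[OF this reduce[of f]] show "S (a f) (c f)" by (simp add: S_def)
  next
    assume "S (a f) (c f)"
    from lattice_add[OF reduce[of f] this[unfolded S_def]] show "in_lattice f" by simp
  qed
  let ?H = "integer_mod_group n \<times>\<times> integer_mod_group n'"
  define p r where "p f = u * a f + v * c f" and "r f = w * c f - z * a f" for f
  define \<Phi> where "\<Phi> f = (p f mod int n, r f mod int n')" for f
  have mod_closed: "x mod int l \<in> carrier (integer_mod_group l)" for x l
    by (simp add: carrier_integer_mod_group)
  have "group (critical_group G b) \<and> critical_group G b \<cong> ?H"
  proof (rule critical_group_iso[where \<Phi> = \<Phi>])
    show "group ?H" by (simp add: DirProd_group)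
    show "\<Phi> f \<in> carrier ?H" for f
      by (simp add: \<Phi>_def DirProd_def mod_closed)
    show "\<Phi> (\<lambda>v. f v + g v) = \<Phi> f \<otimes>\<^bsub>?H\<^esub> \<Phi> g" for f g
    proof -
      have "p (\<lambda>v. f v + g v) = p f + p g" "r (\<lambda>v. f v + g v) = r f + r g"
        by (simp_all add: p_def r_def a_def c_def algebra_simps sum.distrib)
      then show ?thesis by (simp add: \<Phi>_def DirProd_def mod_add_eq)
    qed
    show "\<Phi> f = \<one>\<^bsub>?H\<^esub> \<longleftrightarrow> in_lattice f" for f
      by (simp add: \<Phi>_def DirProd_def lattice_iff S p_def r_def dvd_eq_mod_eq_0)
    show "carrier ?H \<subseteq> range \<Phi>"
    proof
      fix e assume "e \<in> carrier ?H"
      then obtain x y where e: "e = (x, y)" "x mod int n = x" "y mod int n' = y"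
        by (cases e) (auto simp: DirProd_def carrier_integer_mod_group split: if_splits)
      \<comment> \<open>The plane vector with coordinates \<open>x\<close> and \<open>y\<close> in
        the basis \<open>(w, z)\<close>, \<open>(- v, u)\<close>.\<close>
      define X Y where "X = x * w - y * v" and "Y = x * z + y * u"
      define f where "f i = X * g\<^sub>1 i + Y * g\<^sub>2 i" for i
      \<comment> \<open>The coefficients that \<open>a\<close> and \<open>c\<close> assign to
        \<open>f\<close> may differ from \<open>X\<close> and \<open>Y\<close>, but only by a
        relation.\<close>
      have "S (X - a f) (Y - c f)"
        using reduce[of f] by (simp add: S_def f_def algebra_simps)
      then have "int n dvd (u * X + v * Y) - p f" "int n' dvd (w * Y - z * X) - r f"
        by (simp_all add: S p_def r_def algebra_simps)
      moreover have "u * X + v * Y = x * (u * w + v * z)" "w * Y - z * X = y * (u * w + v * z)"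
        by (simp_all add: X_def Y_def algebra_simps)
      ultimately have "x mod int n = p f mod int n" "y mod int n' = r f mod int n'"
        by (simp_all add: unimod mod_eq_dvd_iff)
      with e have "e = \<Phi> f" by (simp add: \<Phi>_def)
      then show "e \<in> range \<Phi>" by blast
    qed
  qed
  then show ?thesis by blast
qed

end

section \<open>Wheels\<close>

lemma rim_prev_next:
  assumes "i \<in> {1..k}" "j \<in> {1..k}"
  shows "j = rim_prev k i \<longleftrightarrow> i = rim_next k j" "j = rim_next k i \<longleftrightarrow> i = rim_prev k j"
  using assms by (auto simp: rim_prev_def rim_next_def split: if_splits)

lemma rim_prev_next_in:
  assumes "i \<in> {1..k}"
  shows "rim_prev k i \<in> {1..k}" "rim_next k i \<in> {1..k}"
  using assms by (auto simp: rim_prev_def rim_next_def)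

lemma verts_wheel: "verts (wheel k q t) - {0} = {1..k}"
  by (auto simp: wheel_def)

text \<open>Backward and forward arcs are counted by separate summands, so the loops for
  \<open>k = 1\<close> and the coinciding neighbours for \<open>k = 2\<close> are covered
  uniformly.\<close>

lemma sum_mult_arcs_wheel:
  assumes "i \<in> {1..k}"
  shows "(\<Sum>j\<in>{1..k}. mult_arcs (wheel k q t) i j) = 1 + q"
    and "(\<Sum>j\<in>{1..k}. mult_arcs (wheel k q t) j i) = 1 + q"
proof -
  show "(\<Sum>j\<in>{1..k}. mult_arcs (wheel k q t) i j) = 1 + q"
    using rim_prev_next_in[OF assms]
    by (simp add: mult_arcs_wheel_rim[OF assms] sum.distrib del: atLeastAtMost_iff)
  have "(\<Sum>j\<in>{1..k}. mult_arcs (wheel k q t) j i) =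
      (\<Sum>j\<in>{1..k}. (if j = rim_next k i then 1 else 0) + (if j = rim_prev k i then q else 0))"
    by (intro sum.cong refl)
      (simp only: mult_arcs_wheel_rim assms rim_prev_next[where j = i and k = k])
  also have "\<dots> = 1 + q"
    using rim_prev_next_in[OF assms] by (simp add: sum.distrib del: atLeastAtMost_iff)
  finally show "(\<Sum>j\<in>{1..k}. mult_arcs (wheel k q t) j i) = 1 + q" .
qed

lemma eulerian_cone_wheel:
  assumes "t \<ge> 1"
  shows "eulerian_cone (wheel k q t) 0 t"
proof unfold_locales
  show "finite (verts (wheel k q t))" "0 \<in> verts (wheel k q t)" by (simp_all add: wheel_def)
  show "t > 0" using assms by simp
qed (unfold verts_wheel, simp_all only: sum_mult_arcs_wheel out_degree_wheel_rim mult_arcs_wheel_hub)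

theorem theorem10:
  fixes q t k :: nat
  assumes "t \<ge> 1" and "k \<ge> 1"
  shows "group (critical_group (wheel k q t) 0) \<and>
    (\<exists>(A :: int monoid) (B :: int monoid).
       group A \<and> cyclic_group A \<and> group B \<and> cyclic_group B \<and>
       critical_group (wheel k q t) 0 \<cong> A \<times>\<times> B)"
proof -
  interpret eulerian_cone "wheel k q t" 0 t by (rule eulerian_cone_wheel) fact
  define e :: "nat \<Rightarrow> nat \<Rightarrow> int" where "e i v = (if v = i then 1 else 0)" for i v
  \<comment> \<open>The unit vectors at the last rim vertex and its predecessor; for
    \<open>k = 1\<close> they coincide.\<close>
  define g\<^sub>1 g\<^sub>2 where "g\<^sub>1 = e k" and "g\<^sub>2 = e (rim_prev k k)"
  define P where "P i \<longleftrightarrow> (\<exists>x y. in_lattice (\<lambda>v. e i v - (x * g\<^sub>1 v + y * g\<^sub>2 v)))" for i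
  have relation: "in_lattice (\<lambda>v. int (1 + q + t) * e i v - e (rim_prev k i) v - int q * e (rim_next k i) v)"
    if "i \<in> {1..k}" for i
  proof -
    have "in_lattice (\<lambda>v. (if v = i then int (1 + q + t) else 0) - int (m i v))"
      using lattice_firing[of i] that by (simp only: verts_wheel out_degree_wheel_rim)
    also have "?this \<longleftrightarrow> ?thesis"
      using that by (intro lattice_cong ballI) (simp only: verts_wheel mult_arcs_wheel_rim, simp add: e_def)
    finally show ?thesis .
  qed
  have P_k: "P k" unfolding P_def
    by (rule exI[of _ 1], rule exI[of _ 0]) (simp add: g\<^sub>1_def)
  have P_prev_k: "P (rim_prev k k)" unfolding P_def
    by (rule exI[of _ 0], rule exI[of _ 1]) (simp add: g\<^sub>2_def)
  \<comment> \<open>In the firing relation at \<open>i\<close> the predecessor has coefficient of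
    absolute value 1, whereas the successor has \<open>q\<close>. Hence generation spreads backwards
    along the rim.\<close>
  have P_prev: "P (rim_prev k i)" if i: "i \<in> {1..k}" and P: "P i" "P (rim_next k i)" for i
  proof -
    obtain x y x' y' where
      1: "in_lattice (\<lambda>v. e i v - (x * g\<^sub>1 v + y * g\<^sub>2 v))" and
      2: "in_lattice (\<lambda>v. e (rim_next k i) v - (x' * g\<^sub>1 v + y' * g\<^sub>2 v))"
      using P unfolding P_def by blast
    let ?s = "int (1 + q + t)"
    have "in_lattice (\<lambda>v. (?s * (e i v - (x * g\<^sub>1 v + y * g\<^sub>2 v)) + - int q * (e (rim_next k i) v - (x' * g\<^sub>1 v + y' * g\<^sub>2 v)))
       - (?s * e i v - e (rim_prev k i) v - int q * e (rim_next k i) v))"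
      by (intro lattice_diff[OF lattice_combination[OF 1 2] relation[OF i]])
    also have "(\<lambda>v. (?s * (e i v - (x * g\<^sub>1 v + y * g\<^sub>2 v)) + - int q * (e (rim_next k i) v - (x' * g\<^sub>1 v + y' * g\<^sub>2 v)))
       - (?s * e i v - e (rim_prev k i) v - int q * e (rim_next k i) v)) =
      (\<lambda>v. e (rim_prev k i) v - ((?s * x - int q * x') * g\<^sub>1 v + (?s * y - int q * y') * g\<^sub>2 v))"
      by (simp add: fun_eq_iff algebra_simps)
    finally show ?thesis unfolding P_def by blast
  qed
  \<comment> \<open>The recurrence has order two, so the induction carries two adjacent
    vertices.\<close>
  have P_down: "P (k - j) \<and> P (rim_prev k (k - j))" if "j < k" for j
    using that
  proof (induction j)
    case 0
    then show ?case using P_k P_prev_k by simp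
  next
    case (Suc j)
    then have eq: "rim_prev k (k - j) = k - Suc j" "rim_next k (k - Suc j) = k - j"
      by (auto simp: rim_prev_def rim_next_def)
    with Suc show ?case using P_prev[of "k - Suc j"] by auto
  qed
  have "P i" if "i \<in> {1..k}" for i
    using P_down[of "k - i"] that by auto
  then have "\<exists>n n'. group (critical_group (wheel k q t) 0) \<and>
    critical_group (wheel k q t) 0 \<cong> integer_mod_group n \<times>\<times> integer_mod_group n'"
    by (intro critical_group_two_generators[of g\<^sub>1 g\<^sub>2])
      (simp only: verts_wheel P_def e_def)
  then show ?thesis
    using group_integer_mod_group cyclic_integer_mod_group by blast
qed

end
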